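(* Let $\Omega\subset\mathbb{R}^3$ be a polyhedron (compact, with nonempty interior) and let $B\supseteq\Omega$ be a Cartesian bounding box of $\Omega$. Let $d\mu=\sigma(P)\,dP$ be an absolutely continuous measure on $B$ with $\sigma\in L^1_+(B)$, and suppose that $1/\sigma\in L^1_+(\Omega)$. For each $n\ge 0$ let $N=\dim(\mathbb{P}_n^3)=(n+1)(n+2)(n+3)/6$, let $\{\phi_j\}_{1\le j\le N}$ be a basis of $\mathbb{P}_n^3$ that is orthonormal with respect to $\mu$, and let $\{P_i\}_{1\le i\le\nu}\subset B$ and $\{u_i\}_{1\le i\le \nu}$, with $u_i>0$ and $\nu=\nu(n)$, be the nodes and weights of a quadrature formula for $\mu$ that is exact on $\mathbb{P}_{2n}^3$, i.e. $\int_B p\,d\mu=\sum_{i=1}^{\nu}u_i\,p(P_i)$ for all $p\in\mathbb{P}_{2n}^3$. Define $$m_j=\int_\Omega \phi_j(P)\,dP,\quad 1\le j\le N,\qquad w_i=u_i\sum_{j=1}^N\phi_j(P_i)\,m_j,\quad 1\le i\le\nu$$ (the $\phi_j$, $m_j$, $P_i$, $u_i$, $w_i$ all depend on $n$). Then for every $n$ $$\int_\Omega f(P)\,dP=\sum_{i=1}^{\nu}w_i\,f(P_i)\qquad\text{for all } f\in\mathbb{P}_n^3,$$ and moreover $$\lim_{n\to\infty}\sum_{i=1}^{\nu}|w_i|=\mathrm{vol}(\Omega).$$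
   Context: $\mathbb{P}_n^3$ denotes the space of real polynomials in three variables of total degree at most $n$. $P=(x,y,z)$, $dP=dx\,dy\,dz$ is Lebesgue measure, and $\mathrm{vol}(\Omega)$ is the Lebesgue measure of $\Omega$. A Cartesian bounding box is a product of three compact nondegenerate intervals, $[a_1,b_1]\times[a_2,b_2]\times[a_3,b_3]$. $L^1_+(A)$ denotes the (almost everywhere) nonnegative Lebesgue-integrable functions on $A$; the condition $1/\sigma\in L^1_+(\Omega)$ in particular means that $\sigma>0$ almost everywhere on $\Omega$. Orthonormality with respect to $\mu$ means $\int_B\phi_j\phi_k\,d\mu=\delta_{jk}$. *)

theory Defs
  imports "HOL-Analysis.Analysis"
begin

text \<open>
  The library constant \<^const>\<open>polyhedron\<close> describes only convex sets (finite intersections of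
  halfspaces).  Here a polyhedron need not be convex: it is a finite union of convex polytopes.
\<close>

definition general_polyhedron :: "'a::euclidean_space set \<Rightarrow> bool" where
  "general_polyhedron S \<longleftrightarrow> (\<exists>\<T>. finite \<T> \<and> (\<forall>T\<in>\<T>. polytope T) \<and> S = \<Union>\<T>)"

definition bounding_box :: "(real ^ 3) set \<Rightarrow> (real ^ 3) set \<Rightarrow> bool" where
  "bounding_box B S \<longleftrightarrow> (\<exists>a b. (\<forall>i. a $ i < b $ i) \<and> B = cbox a b) \<and> S \<subseteq> B"

text \<open>
  Since \<open>1 / 0 = 0\<close> in HOL, membership of \<open>1 / \<sigma>\<close> in this class does not by itself force
  \<open>\<sigma> > 0\<close> almost everywhere; positivity has to be assumed separately.
\<close>

definition L1_plus :: "'a::euclidean_space set \<Rightarrow> ('a \<Rightarrow> real) set" where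
  "L1_plus A = {f. integrable (lebesgue_on A) f \<and> (AE x in lebesgue_on A. 0 \<le> f x)}"

definition density_measure :: "(real ^ 3) set \<Rightarrow> (real ^ 3 \<Rightarrow> real) \<Rightarrow> (real ^ 3) measure" where
  "density_measure B \<sigma> = density (lebesgue_on B) (\<lambda>x. ennreal (\<sigma> x))"

definition exponents3 :: "nat \<Rightarrow> (nat \<times> nat \<times> nat) set" where
  "exponents3 n = {(i, j, k). i + j + k \<le> n}"

text \<open>Polynomials are identified with the functions they induce on \<open>\<real>\<^sup>3\<close>.\<close>

definition poly3 :: "nat \<Rightarrow> (real ^ 3 \<Rightarrow> real) set" where
  "poly3 n = {p. \<exists>c. \<forall>x. p x =
     (\<Sum>(i, j, k)\<in>exponents3 n. c i j k * (x $ 1) ^ i * (x $ 2) ^ j * (x $ 3) ^ k)}"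

definition dim_poly3 :: "nat \<Rightarrow> nat" where
  "dim_poly3 n = (n + 1) * (n + 2) * (n + 3) div 6"

definition basis_poly3 :: "nat \<Rightarrow> (nat \<Rightarrow> real ^ 3 \<Rightarrow> real) \<Rightarrow> bool" where
  "basis_poly3 n \<phi> \<longleftrightarrow>
     (\<forall>j\<in>{1..dim_poly3 n}. \<phi> j \<in> poly3 n) \<and>
     (\<forall>c. (\<forall>x. (\<Sum>j=1..dim_poly3 n. c j * \<phi> j x) = 0) \<longrightarrow> (\<forall>j\<in>{1..dim_poly3 n}. c j = 0)) \<and>
     (\<forall>p\<in>poly3 n. \<exists>c. \<forall>x. p x = (\<Sum>j=1..dim_poly3 n. c j * \<phi> j x))"

definition orthonormal_wrt :: "'a measure \<Rightarrow> 'i set \<Rightarrow> ('i \<Rightarrow> 'a \<Rightarrow> real) \<Rightarrow> bool" where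
  "orthonormal_wrt M I \<phi> \<longleftrightarrow>
     (\<forall>j\<in>I. \<forall>k\<in>I. (\<integral>x. \<phi> j x * \<phi> k x \<partial>M) = (if j = k then 1 else 0))"

definition exact_on :: "'a measure \<Rightarrow> nat \<Rightarrow> (nat \<Rightarrow> 'a) \<Rightarrow> (nat \<Rightarrow> real) \<Rightarrow> ('a \<Rightarrow> real) set \<Rightarrow> bool" where
  "exact_on M \<nu> P u V \<longleftrightarrow> (\<forall>p\<in>V. (\<integral>x. p x \<partial>M) = (\<Sum>i=1..\<nu>. u i * p (P i)))"

lemma finite_exponents3: "finite (exponents3 n)"
proof (rule finite_subset)
  show "exponents3 n \<subseteq> {..n} \<times> {..n} \<times> {..n}" by (auto simp: exponents3_def)
qed simp

lemma card_exponents3: "card (exponents3 n) = dim_poly3 n"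
proof -
  have tri: "2 * (\<Sum>j\<le>m. Suc (m - j)) = (m + 1) * (m + 2)" for m :: nat
  proof (induction m)
    case (Suc m)
    have "(\<Sum>j\<le>Suc m. Suc (Suc m - j)) = Suc (Suc m) + (\<Sum>j\<le>m. Suc (m - j))"
      by (subst sum.atMost_Suc_shift) simp
    then show ?case using Suc by simp
  qed simp
  have tet: "6 * (\<Sum>i\<le>m. \<Sum>j\<le>m - i. Suc (m - i - j)) = (m + 1) * (m + 2) * (m + 3)" for m :: nat
  proof (induction m)
    case (Suc m)
    have "(\<Sum>i\<le>Suc m. \<Sum>j\<le>Suc m - i. Suc (Suc m - i - j))
        = (\<Sum>j\<le>Suc m. Suc (Suc m - j)) + (\<Sum>i\<le>m. \<Sum>j\<le>m - i. Suc (m - i - j))"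
      by (subst sum.atMost_Suc_shift) (simp del: sum.atMost_Suc)
    moreover note tri[of "Suc m"] Suc
    ultimately show ?case by (simp add: algebra_simps del: sum.atMost_Suc)
  qed simp
  have "exponents3 n = (SIGMA i:{..n}. SIGMA j:{..n - i}. {..n - i - j})"
    by (auto simp: exponents3_def)
  then have "card (exponents3 n) = (\<Sum>i\<le>n. \<Sum>j\<le>n - i. Suc (n - i - j))"
    by simp
  with tet[of n] show ?thesis by (simp add: dim_poly3_def)
qed

end

theory Submission
  imports Defs
begin

text \<open>
  Let \<open>h = 1 / \<sigma>\<close> on \<open>\<Omega>\<close> and \<open>0\<close> elsewhere.  Since \<open>1 / \<sigma>\<close> is integrable on \<open>\<Omega>\<close>, \<open>h\<close> is square
  integrable for \<open>\<mu>\<close>, the \<open>m\<^sub>j\<close> are its Fourier coefficients, and \<open>w\<^sub>i = u\<^sub>i g\<^sub>n(P\<^sub>i)\<close> where \<open>g\<^sub>n\<close> is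
  the orthogonal projection of \<open>h\<close> onto the polynomials of degree at most \<open>n\<close>.  Exactness in degree
  \<open>2n\<close> gives the cubature formula, and with \<open>f = 1\<close> the lower bound \<open>vol(\<Omega>)\<close> for \<open>\<Sum>|w\<^sub>i|\<close>.

  For the upper bound, take a polynomial \<open>q\<close>, nonnegative on \<open>B\<close> and close to \<open>h\<close> in \<open>L\<^sup>2(\<mu>)\<close>.  Then
  \<open>\<Sum>|w\<^sub>i| \<le> \<Sum>u\<^sub>i|g\<^sub>n - q|(P\<^sub>i) + \<Sum>u\<^sub>i q(P\<^sub>i)\<close>.  The last sum is the integral of \<open>q\<close>, which is close to
  that of \<open>h\<close>, namely \<open>vol(\<Omega>)\<close>; the other one is controlled through the exactness of the formula
  for \<open>(g\<^sub>n - q)\<^sup>2\<close> and the fact that \<open>g\<^sub>n - q\<close> is the projection of \<open>h - q\<close>.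
\<close>

section \<open>Polynomials of bounded total degree in three variables\<close>

definition monomial3 :: "nat \<times> nat \<times> nat \<Rightarrow> real ^ 3 \<Rightarrow> real" where
  "monomial3 e x = (x $ 1) ^ fst e * (x $ 2) ^ fst (snd e) * (x $ 3) ^ snd (snd e)"

text \<open>With \<open>poly3E\<close> this trades the curried coefficients of \<open>poly3\<close>
  for one function on exponent triples, so that the closure proofs work with a single finite
  sum.\<close>

lemma poly3I: "p \<in> poly3 n"
  if "\<And>x. p x = (\<Sum>e\<in>exponents3 n. c e * monomial3 e x)"
  unfolding poly3_def
  by (rule CollectI, rule exI[of _ "\<lambda>i j k. c (i, j, k)"])
    (simp add: that case_prod_beta mult.assoc monomial3_def)

lemma poly3E:
  assumes "p \<in> poly3 n"
  obtains c where "\<And>x. p x = (\<Sum>e\<in>exponents3 n. c e * monomial3 e x)"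
proof -
  obtain c where "\<And>x. p x = (\<Sum>(i, j, k)\<in>exponents3 n. c i j k * (x $ 1) ^ i * (x $ 2) ^ j * (x $ 3) ^ k)"
    using assms unfolding poly3_def by blast
  then show thesis
    by (intro that[of "\<lambda>e. c (fst e) (fst (snd e)) (snd (snd e))"])
      (simp add: case_prod_beta mult.assoc monomial3_def)
qed

lemma poly3_add: "p \<in> poly3 n \<Longrightarrow> q \<in> poly3 n \<Longrightarrow> (\<lambda>x. p x + q x) \<in> poly3 n"
proof (elim poly3E)
  fix c d
  assume "\<And>x. p x = (\<Sum>e\<in>exponents3 n. c e * monomial3 e x)"
    and "\<And>x. q x = (\<Sum>e\<in>exponents3 n. d e * monomial3 e x)"
  then show ?thesis
    by (intro poly3I[of _ "\<lambda>e. c e + d e"]) (simp add: distrib_right sum.distrib)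
qed

lemma poly3_cmult: "p \<in> poly3 n \<Longrightarrow> (\<lambda>x. a * p x) \<in> poly3 n"
proof (elim poly3E)
  fix c
  assume "\<And>x. p x = (\<Sum>e\<in>exponents3 n. c e * monomial3 e x)"
  then show ?thesis
    by (intro poly3I[of _ "\<lambda>e. a * c e"]) (simp add: sum_distrib_left mult.assoc)
qed

lemma poly3_monomial:
  assumes "e \<in> exponents3 n"
  shows "monomial3 e \<in> poly3 n"
  by (rule poly3I[of _ "\<lambda>d. if d = e then 1 else 0"])
    (simp add: if_distrib[of "\<lambda>r. r * _"] finite_exponents3 assms cong: if_cong)

lemma poly3_zero: "(\<lambda>x. 0) \<in> poly3 n"
  by (rule poly3I[of _ "\<lambda>_. 0"]) simp

lemma poly3_sum: "(\<And>i. i \<in> I \<Longrightarrow> f i \<in> poly3 n) \<Longrightarrow> (\<lambda>x. \<Sum>i\<in>I. f i x) \<in> poly3 n"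
  by (induction I rule: infinite_finite_induct) (simp_all add: poly3_zero poly3_add)

text \<open>Multiplying monomials adds exponents, hence total degrees; bilinearity does the rest.
  With m = n this gives the degree 2n in which the quadrature is exact.\<close>

lemma poly3_mult:
  assumes p: "p \<in> poly3 m" and q: "q \<in> poly3 n"
  shows "(\<lambda>x. p x * q x) \<in> poly3 (m + n)"
proof -
  obtain c where c: "\<And>x. p x = (\<Sum>e\<in>exponents3 m. c e * monomial3 e x)"
    using poly3E[OF p] by blast
  obtain d where d: "\<And>x. q x = (\<Sum>e\<in>exponents3 n. d e * monomial3 e x)"
    using poly3E[OF q] by blast
  have "(\<lambda>x. monomial3 e x * monomial3 f x) \<in> poly3 (m + n)"
    if "e \<in> exponents3 m" "f \<in> exponents3 n" for e f
  proof -
    have "(\<lambda>x. monomial3 e x * monomial3 f x)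
        = (\<lambda>x. monomial3 (fst e + fst f, fst (snd e) + fst (snd f), snd (snd e) + snd (snd f)) x)"
      by (simp add: monomial3_def power_add fun_eq_iff)
    also have "\<dots> \<in> poly3 (m + n)"
      using that by (intro poly3_monomial) (auto simp: exponents3_def)
    finally show ?thesis .
  qed
  then have "(\<lambda>x. \<Sum>e\<in>exponents3 m. \<Sum>f\<in>exponents3 n. (c e * d f) * (monomial3 e x * monomial3 f x)) \<in> poly3 (m + n)"
    by (intro poly3_sum poly3_cmult)
  moreover have "(\<lambda>x. p x * q x) = (\<lambda>x. \<Sum>e\<in>exponents3 m. \<Sum>f\<in>exponents3 n. (c e * d f) * (monomial3 e x * monomial3 f x))"
    unfolding c d by (simp add: sum_product mult_ac)
  ultimately show ?thesis by simp
qed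

lemma poly3_const: "(\<lambda>x. a) \<in> poly3 n"
  using poly3_cmult[OF poly3_monomial[of "(0, 0, 0)" n], of a] by (simp add: exponents3_def monomial3_def)

lemma poly3_mono:
  assumes "p \<in> poly3 m" "m \<le> n"
  shows "p \<in> poly3 n"
  \<comment> \<open>The constant 1, read as a polynomial of degree at most \<open>n - m\<close>,
    lifts the degree bound without changing p.\<close>
  using poly3_mult[OF assms(1) poly3_const[of 1 "n - m"]] assms(2) by simp

lemma poly3_coordinate: "(\<lambda>x. x $ i) \<in> poly3 1"
proof -
  have "i = 1 \<or> i = 2 \<or> i = 3" by (rule exhaust_3)
  moreover have "(\<lambda>x. x $ 1) = monomial3 (1, 0, 0)" "(\<lambda>x. x $ 2) = monomial3 (0, 1, 0)"
    "(\<lambda>x. x $ 3) = monomial3 (0, 0, 1)"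
    by (simp_all add: monomial3_def fun_eq_iff)
  ultimately show ?thesis
    by (elim disjE) (simp_all add: poly3_monomial exponents3_def)
qed

lemma continuous_on_poly3:
  assumes "p \<in> poly3 n"
  shows "continuous_on S p"
proof -
  obtain c where c: "\<And>x. p x = (\<Sum>e\<in>exponents3 n. c e * monomial3 e x)"
    using poly3E[OF assms] by blast
  show ?thesis
    unfolding c[abs_def] monomial3_def by (intro continuous_intros)
qed

text \<open>Translates the polynomials delivered by Stone-Weierstrass into \<open>poly3\<close>. A
  linear functional is a combination of coordinates by basis expansion; the other cases are the
  closure properties above.\<close>

lemma real_polynomial_function_imp_poly3:
  fixes q :: "real ^ 3 \<Rightarrow> real"
  assumes "real_polynomial_function q"
  shows "\<exists>n. q \<in> poly3 n"
  using assms
proof (induction rule: real_polynomial_function.induct)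
  case (linear f)
  have "f x = (\<Sum>i\<in>UNIV. f (axis i 1) * x $ i)" for x
  proof -
    have "f x = f (\<Sum>i\<in>UNIV. x $ i *\<^sub>R axis i 1)"
      using basis_expansion[of x] by (simp add: scalar_mult_eq_scaleR)
    also have "\<dots> = (\<Sum>i\<in>UNIV. f (axis i 1) * x $ i)"
      using linear by (simp add: bounded_linear.linear linear_sum linear_scale mult.commute)
    finally show ?thesis .
  qed
  then have "f = (\<lambda>x. \<Sum>i\<in>UNIV. f (axis i 1) * x $ i)" by blast
  also have "\<dots> \<in> poly3 1" by (intro poly3_sum poly3_cmult poly3_coordinate)
  finally show ?case by blast
next
  case (const c)
  then show ?case using poly3_const by blast
next
  case (add f g)
  then obtain m n where "f \<in> poly3 m" "g \<in> poly3 n" by blast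
  then have "f \<in> poly3 (max m n)" "g \<in> poly3 (max m n)" by (auto intro: poly3_mono)
  then show ?case using poly3_add by blast
next
  case (mult f g)
  then show ?case using poly3_mult by blast
qed

section \<open>Approximation in L2 by nonnegative polynomials\<close>

lemma integrable_continuous_on_compact:
  fixes f :: "'a::euclidean_space \<Rightarrow> real"
  assumes "finite_measure M" "compact B" and M: "sets M = sets (lebesgue_on B)"
    and f: "continuous_on B f"
  shows "integrable M f"
proof -
  interpret finite_measure M by fact
  have sp: "space M = B" using sets_eq_imp_space_eq[OF M] by simp
  have "bounded (f ` B)" using assms by (simp add: compact_continuous_image compact_imp_bounded)
  then obtain K where "\<And>x. x \<in> B \<Longrightarrow> norm (f x) \<le> K"
    unfolding bounded_iff by blast
  moreover have "f \<in> borel_measurable M"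
    using continuous_imp_measurable_on_sets_lebesgue[OF f] \<open>compact B\<close>
    by (simp add: measurable_cong_sets[OF M refl] compact_imp_closed)
  ultimately show ?thesis by (intro integrable_const_bound[of _ K]) (auto simp: sp)
qed

text \<open>At each point the integrand vanishes once k reaches \<open>h x\<close>, and the square
  of h dominates it for every k.\<close>

lemma L2_approx_truncation:
  fixes h :: "'a \<Rightarrow> real"
  assumes h: "h \<in> borel_measurable M" "\<And>x. 0 \<le> h x" and h2: "integrable M (\<lambda>x. (h x)\<^sup>2)"
  shows "(\<lambda>k. \<integral>x. (h x - min (real k) (h x))\<^sup>2 \<partial>M) \<longlonglongrightarrow> 0"
proof -
  note h(1)[measurable]
  have "(\<lambda>k. \<integral>x. (h x - min (real k) (h x))\<^sup>2 \<partial>M) \<longlonglongrightarrow> (\<integral>x. 0 \<partial>M)"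
  proof (rule integral_dominated_convergence[where w = "\<lambda>x. (h x)\<^sup>2"])
    show "AE x in M. (\<lambda>k. (h x - min (real k) (h x))\<^sup>2) \<longlonglongrightarrow> 0"
    proof (rule AE_I2)
      fix x
      obtain k0 :: nat where "h x \<le> real k0" using real_arch_simple by blast
      then have "\<forall>\<^sub>F k in sequentially. (h x - min (real k) (h x))\<^sup>2 = 0"
        by (intro eventually_sequentiallyI[of k0]) auto
      then show "(\<lambda>k. (h x - min (real k) (h x))\<^sup>2) \<longlonglongrightarrow> 0"
        by (rule tendsto_eventually)
    qed
    show "AE x in M. norm ((h x - min (real k) (h x))\<^sup>2) \<le> (h x)\<^sup>2" for k
      using h(2) by (auto intro!: power_mono simp: min_def)
  qed (use h2 in auto)
  then show ?thesis by simp
qed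

text \<open>Lebesgue measurability provides continuous functions converging to h off a negligible
  set, which \<open>ac\<close> makes null for M. Truncated at k, they converge boundedly, and M is
  finite.\<close>

lemma L2_approx_continuous:
  fixes h :: "'a::euclidean_space \<Rightarrow> real"
  assumes "finite_measure M" "compact B" and M: "sets M = sets (lebesgue_on B)"
    and ac: "\<And>N. negligible N \<Longrightarrow> AE x in M. x \<notin> N"
    and h: "h \<in> borel_measurable M" "\<And>x. 0 \<le> h x" and "0 < e"
  obtains c where "continuous_on UNIV c" "\<And>x. 0 \<le> c x"
    "integrable M (\<lambda>x. (min (real k) (h x) - c x)\<^sup>2)"
    "(\<integral>x. (min (real k) (h x) - c x)\<^sup>2 \<partial>M) < e"
proof -
  interpret finite_measure M by fact
  note h(1)[measurable]
  have sp: "space M = B" using sets_eq_imp_space_eq[OF M] by simp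
  have B: "B \<in> sets lebesgue" using \<open>compact B\<close> by (simp add: compact_imp_closed)
  have "h measurable_on B"
    using h B by (simp add: measurable_on_iff_borel_measurable measurable_cong_sets[OF M refl])
  then obtain N g where N: "negligible N" and g: "\<And>n. continuous_on UNIV (g n)"
    and lim: "\<And>x. x \<notin> N \<Longrightarrow> (\<lambda>n. g n x) \<longlonglongrightarrow> (if x \<in> B then h x else 0)"
    unfolding measurable_on_def by blast
  \<comment> \<open>Clamping to [0, k] preserves continuity and, as h is nonnegative, turns the
    limit h into \<open>min (real k) (h x)\<close>; both terms then lie in [0, k], so they differ by
    at most k.\<close>
  define c where "c n x = min (real k) (max 0 (g n x))" for n x
  have cont: "continuous_on S (c n)" for n S
    unfolding c_def by (intro continuous_intros continuous_on_subset[OF g]) auto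
  have [measurable]: "c n \<in> borel_measurable M" for n
    using integrable_continuous_on_compact[OF assms(1-3) cont] by simp
  have bound: "norm ((min (real k) (h x) - c n x)\<^sup>2) \<le> (real k)\<^sup>2" for n x
  proof -
    have "\<bar>min (real k) (h x) - c n x\<bar> \<le> \<bar>real k\<bar>"
      using h(2)[of x] by (auto simp: c_def)
    then show ?thesis using abs_le_square_iff[THEN iffD1] by fastforce
  qed
  have "(\<lambda>n. \<integral>x. (min (real k) (h x) - c n x)\<^sup>2 \<partial>M) \<longlonglongrightarrow> (\<integral>x. 0 \<partial>M)"
  proof (rule integral_dominated_convergence[where w = "\<lambda>x. (real k)\<^sup>2"])
    show "AE x in M. (\<lambda>n. (min (real k) (h x) - c n x)\<^sup>2) \<longlonglongrightarrow> 0"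
      using ac[OF N] AE_space
    proof eventually_elim
      case (elim x)
      then have "(\<lambda>n. g n x) \<longlonglongrightarrow> h x" using lim[of x] by (simp add: sp)
      then have "(\<lambda>n. (min (real k) (h x) - c n x)\<^sup>2) \<longlonglongrightarrow> (min (real k) (h x) - min (real k) (max 0 (h x)))\<^sup>2"
        unfolding c_def by (intro tendsto_intros)
      then show ?case using h(2)[of x] by simp
    qed
  qed (use bound in auto)
  then have "\<forall>\<^sub>F n in sequentially. (\<integral>x. (min (real k) (h x) - c n x)\<^sup>2 \<partial>M) < e"
    using \<open>0 < e\<close> by (simp add: order_tendstoD(2))
  then obtain n where n: "(\<integral>x. (min (real k) (h x) - c n x)\<^sup>2 \<partial>M) < e"
    using eventually_happens'[OF sequentially_bot] by blast
  have "integrable M (\<lambda>x. (min (real k) (h x) - c n x)\<^sup>2)"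
    using bound by (intro integrable_const_bound[of _ "(real k)\<^sup>2"]) auto
  with n show thesis
    by (intro that[of "c n"] cont) (auto simp: c_def)
qed

text \<open>Three approximations in a row: truncation, a continuous function c, a polynomial. Each
  has squared error below e / 9, and the square of a sum of three terms is at most 3 times the sum
  of the squares, so the total stays below e.\<close>

lemma L2_approx_nonneg_polynomial:
  fixes h :: "'a::euclidean_space \<Rightarrow> real"
  assumes fin: "finite_measure M" and B: "compact B" and M: "sets M = sets (lebesgue_on B)"
    and ac: "\<And>N. negligible N \<Longrightarrow> AE x in M. x \<notin> N"
    and h: "h \<in> borel_measurable M" "\<And>x. 0 \<le> h x" and h2: "integrable M (\<lambda>x. (h x)\<^sup>2)"
    and e: "0 < e"
  obtains q where "real_polynomial_function q" "\<And>x. x \<in> B \<Longrightarrow> 0 \<le> q x"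
    "(\<integral>x. (h x - q x)\<^sup>2 \<partial>M) < e"
proof -
  interpret finite_measure M by fact
  note h(1)[measurable]
  have sp: "space M = B" using sets_eq_imp_space_eq[OF M] by simp
  have "\<forall>\<^sub>F k in sequentially. (\<integral>x. (h x - min (real k) (h x))\<^sup>2 \<partial>M) < e / 9"
    using e by (intro order_tendstoD(2)[OF L2_approx_truncation[OF h h2]]) simp
  then obtain k where k: "(\<integral>x. (h x - min (real k) (h x))\<^sup>2 \<partial>M) < e / 9"
    using eventually_happens'[OF sequentially_bot] by blast
  obtain c where c: "continuous_on UNIV c" "\<And>x. 0 \<le> c x"
    "integrable M (\<lambda>x. (min (real k) (h x) - c x)\<^sup>2)"
    "(\<integral>x. (min (real k) (h x) - c x)\<^sup>2 \<partial>M) < e / 9"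
    using L2_approx_continuous[OF fin B M ac h, of "e / 9" k] e by auto
  \<comment> \<open>Below, |c - q| is at most 2\<eta> on B, which costs at most
    \<open>4 * \<eta>\<^sup>2 * measure M B\<close>; this \<eta> makes that less than e / 9, and the
    added 1 covers a measure of total mass 0.\<close>
  define \<eta> where "\<eta> = sqrt (e / (36 * (measure M B + 1)))"
  have \<eta>: "0 < \<eta>" "\<eta>\<^sup>2 = e / (36 * (measure M B + 1))"
    using e by (auto simp: \<eta>_def add_nonneg_pos)
  have cB: "continuous_on B c" by (rule continuous_on_subset[OF c(1)]) simp
  \<comment> \<open>Approximating c + \<eta> instead of c to within \<eta> forces q > c on B, hence
    q nonnegative there.\<close>
  then have "continuous_on B (\<lambda>x. c x + \<eta>)" by (intro continuous_intros)
  then obtain q where q: "real_polynomial_function q" "\<And>x. x \<in> B \<Longrightarrow> \<bar>(c x + \<eta>) - q x\<bar> < \<eta>"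
    using Stone_Weierstrass_real_polynomial_function[OF B _ \<eta>(1)] by blast
  have qB: "continuous_on B q"
    using q(1) by (simp add: continuous_on_polymonial_function real_polynomial_function_eq)
  have intq: "integrable M (\<lambda>x. (c x - q x)\<^sup>2)"
    by (intro integrable_continuous_on_compact[OF fin B M] continuous_intros cB qB)
  have [measurable]: "q \<in> borel_measurable M"
    using integrable_continuous_on_compact[OF fin B M qB] by simp
  have intk: "integrable M (\<lambda>x. (h x - min (real k) (h x))\<^sup>2)"
    using h(2) by (intro Bochner_Integration.integrable_bound[OF h2])
      (auto intro!: power_mono simp: min_def)
  have "(\<integral>x. (c x - q x)\<^sup>2 \<partial>M) \<le> (\<integral>x. 4 * \<eta>\<^sup>2 \<partial>M)"
  proof (rule integral_mono[OF intq])
    fix x assume "x \<in> space M"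
    then have "\<bar>c x - q x\<bar> \<le> \<bar>2 * \<eta>\<bar>" using q(2)[of x] \<eta>(1) by (simp add: sp)
    then have "(c x - q x)\<^sup>2 \<le> (2 * \<eta>)\<^sup>2" by (simp only: abs_le_square_iff)
    then show "(c x - q x)\<^sup>2 \<le> 4 * \<eta>\<^sup>2" by (simp add: power_mult_distrib)
  qed simp
  also have "\<dots> = (e / 9) * (measure M B / (measure M B + 1))"
    using measure_nonneg[of M B] by (simp add: sp \<eta>(2) divide_simps)
  also have "\<dots> < e / 9"
  proof -
    have "measure M B / (measure M B + 1) < 1"
      by (simp add: add_nonneg_pos)
    from mult_strict_left_mono[OF this, of "e / 9"] show ?thesis using e by simp
  qed
  finally have cq: "(\<integral>x. (c x - q x)\<^sup>2 \<partial>M) < e / 9" .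
  have "(\<integral>x. (h x - q x)\<^sup>2 \<partial>M)
      \<le> (\<integral>x. 3 * ((h x - min (real k) (h x))\<^sup>2 + (min (real k) (h x) - c x)\<^sup>2 + (c x - q x)\<^sup>2) \<partial>M)"
  proof (rule integral_mono')
    have "(a + b + d)\<^sup>2 \<le> 3 * (a\<^sup>2 + b\<^sup>2 + d\<^sup>2)" for a b d :: real
    proof -
      have "0 \<le> (a - b)\<^sup>2 + (b - d)\<^sup>2 + (a - d)\<^sup>2" by simp
      then show ?thesis by (simp add: power2_eq_square algebra_simps)
    qed
    from this[of "h x - min (real k) (h x)" "min (real k) (h x) - c x" "c x - q x" for x]
    show "(h x - q x)\<^sup>2 \<le> 3 * ((h x - min (real k) (h x))\<^sup>2 + (min (real k) (h x) - c x)\<^sup>2 + (c x - q x)\<^sup>2)" for x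
      by simp
  qed (use intk c(3) intq in \<open>auto intro!: integrable_mult_right Bochner_Integration.integrable_add\<close>)
  also have "\<dots> = 3 * ((\<integral>x. (h x - min (real k) (h x))\<^sup>2 \<partial>M) + (\<integral>x. (min (real k) (h x) - c x)\<^sup>2 \<partial>M)
      + (\<integral>x. (c x - q x)\<^sup>2 \<partial>M))"
    using intk c(3) intq by simp
  also have "\<dots> < e" using k c(4) cq by simp
  finally have "(\<integral>x. (h x - q x)\<^sup>2 \<partial>M) < e" .
  moreover have "0 \<le> q x" if "x \<in> B" for x
    using q(2)[OF that] c(2)[of x] by linarith
  ultimately show thesis using that q(1) by blast
qed

section \<open>The weighted measure and the reciprocal of its density\<close>

definition recip_on :: "'a set \<Rightarrow> ('a \<Rightarrow> real) \<Rightarrow> 'a \<Rightarrow> real" where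
  "recip_on S \<sigma> x = (if x \<in> S \<and> 0 < \<sigma> x then 1 / \<sigma> x else 0)"

lemma borel_measurable_recip_on:
  assumes [measurable]: "\<sigma> \<in> borel_measurable M" "S \<in> sets M"
  shows "recip_on S \<sigma> \<in> borel_measurable M"
  unfolding recip_on_def[abs_def] by measurable

lemma sets_density_measure: "sets (density_measure B \<sigma>) = sets (lebesgue_on B)"
  by (simp add: density_measure_def)

lemma finite_measure_density_measure:
  assumes "\<sigma> \<in> L1_plus B"
  shows "finite_measure (density_measure B \<sigma>)"
proof
  have int: "integrable (lebesgue_on B) \<sigma>" using assms by (simp add: L1_plus_def)
  have "emeasure (density_measure B \<sigma>) (space (density_measure B \<sigma>))
      = (\<integral>\<^sup>+x. ennreal (\<sigma> x) * indicator (space (lebesgue_on B)) x \<partial>lebesgue_on B)"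
    unfolding density_measure_def space_density using int by (intro emeasure_density) auto
  \<comment> \<open>\<open>ennreal\<close> sends negative values to 0, so passing to the norm gives
    an upper bound at every point.\<close>
  also have "\<dots> \<le> (\<integral>\<^sup>+x. ennreal (norm (\<sigma> x)) \<partial>lebesgue_on B)"
    by (intro nn_integral_mono) (auto simp: indicator_def intro: ennreal_leI)
  also have "\<dots> < \<infinity>" using int by (simp add: integrable_iff_bounded)
  finally show "emeasure (density_measure B \<sigma>) (space (density_measure B \<sigma>)) \<noteq> \<infinity>" by simp
qed

text \<open>Absolute continuity of the weighted measure, in the form that
  \<open>L2_approx_continuous\<close> asks for as \<open>ac\<close>.\<close>

lemma AE_density_measure_notin_negligible:
  assumes "\<sigma> \<in> L1_plus B" "B \<in> sets lebesgue" "negligible N"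
  shows "AE x in density_measure B \<sigma>. x \<notin> N"
proof -
  have "AE x in lebesgue. x \<notin> N"
    using assms(3) by (intro AE_not_in) (simp add: negligible_iff_null_sets)
  then have "AE x in lebesgue_on B. x \<notin> N"
    using assms(2) by (simp add: AE_restrict_space_iff) (auto elim: eventually_mono)
  moreover have "(\<lambda>x. ennreal (\<sigma> x)) \<in> borel_measurable (lebesgue_on B)"
    using assms(1) by (auto simp: L1_plus_def)
  ultimately show ?thesis
    unfolding density_measure_def by (auto simp: AE_density elim: eventually_mono)
qed

text \<open>The product of \<sigma> and \<open>recip_on \<Omega> \<sigma>\<close> is the indicator
  of \<Omega> almost everywhere on B, so integrals over \<Omega> become inner products with the
  reciprocal in the weighted space.\<close>

lemma density_measure_recip_on:
  assumes B: "B \<in> sets lebesgue" and \<Omega>: "\<Omega> \<in> sets lebesgue" "\<Omega> \<subseteq> B"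
    and \<sigma>: "\<sigma> \<in> L1_plus B" and pos: "AE x in lebesgue_on \<Omega>. 0 < \<sigma> x"
    and f[measurable]: "f \<in> borel_measurable (lebesgue_on B)"
  shows integrable_density_recip_on:
      "integrable (density_measure B \<sigma>) (\<lambda>x. recip_on \<Omega> \<sigma> x * f x) \<longleftrightarrow> integrable (lebesgue_on \<Omega>) f"
    and integral_density_recip_on:
      "(\<integral>x. recip_on \<Omega> \<sigma> x * f x \<partial>density_measure B \<sigma>) = (\<integral>x. f x \<partial>lebesgue_on \<Omega>)"
proof -
  let ?L = "lebesgue_on B"
  have [measurable]: "\<sigma> \<in> borel_measurable ?L" and nn: "AE x in ?L. 0 \<le> \<sigma> x"
    using \<sigma> by (auto simp: L1_plus_def)
  have \<Omega>L[measurable]: "\<Omega> \<in> sets ?L"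
    using B \<Omega> by (simp add: sets_restrict_space_iff)
  have restr: "lebesgue_on \<Omega> = restrict_space ?L \<Omega>"
    using B \<Omega> by (simp add: restrict_restrict_space Int_absorb1)
  have [measurable]: "recip_on \<Omega> \<sigma> \<in> borel_measurable ?L"
    by (intro borel_measurable_recip_on) measurable
  have "AE x in ?L. x \<in> \<Omega> \<longrightarrow> 0 < \<sigma> x"
    using pos \<Omega>L unfolding restr by (subst (asm) AE_restrict_space_iff) auto
  then have ae: "AE x in ?L. \<sigma> x *\<^sub>R (recip_on \<Omega> \<sigma> x * f x) = indicator \<Omega> x *\<^sub>R f x"
    by eventually_elim (auto simp: recip_on_def)
  have \<Omega>i: "\<Omega> \<inter> space ?L \<in> sets ?L" using \<Omega>L \<Omega>(2) by (simp add: Int_absorb2)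
  have "integrable (density_measure B \<sigma>) (\<lambda>x. recip_on \<Omega> \<sigma> x * f x)
      \<longleftrightarrow> integrable ?L (\<lambda>x. \<sigma> x *\<^sub>R (recip_on \<Omega> \<sigma> x * f x))"
    unfolding density_measure_def by (rule integrable_density[OF _ _ nn]) measurable
  also have "\<dots> \<longleftrightarrow> integrable ?L (\<lambda>x. indicator \<Omega> x *\<^sub>R f x)"
    by (rule integrable_cong_AE[OF _ _ ae]) measurable
  finally show "integrable (density_measure B \<sigma>) (\<lambda>x. recip_on \<Omega> \<sigma> x * f x) \<longleftrightarrow> integrable (lebesgue_on \<Omega>) f"
    unfolding restr integrable_restrict_space[OF \<Omega>i] .
  have "(\<integral>x. recip_on \<Omega> \<sigma> x * f x \<partial>density_measure B \<sigma>)
      = (\<integral>x. \<sigma> x *\<^sub>R (recip_on \<Omega> \<sigma> x * f x) \<partial>?L)"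
    unfolding density_measure_def by (rule integral_density[OF _ _ nn]) measurable
  also have "\<dots> = (\<integral>x. indicator \<Omega> x *\<^sub>R f x \<partial>?L)"
    by (rule integral_cong_AE[OF _ _ ae]) measurable
  finally show "(\<integral>x. recip_on \<Omega> \<sigma> x * f x \<partial>density_measure B \<sigma>) = (\<integral>x. f x \<partial>lebesgue_on \<Omega>)"
    unfolding restr integral_restrict_space[OF \<Omega>i] .
qed

section \<open>The cubature formula and the limit of its absolute weights\<close>

lemma abs_le_add_square_div:
  fixes t \<delta> :: real
  assumes "0 < \<delta>"
  shows "\<bar>t\<bar> \<le> \<delta> / 2 + t\<^sup>2 / (2 * \<delta>)"
proof -
  have "0 \<le> (\<bar>t\<bar> - \<delta>)\<^sup>2" by simp
  then have "2 * \<delta> * \<bar>t\<bar> \<le> \<delta>\<^sup>2 + t\<^sup>2" by (simp add: power2_diff algebra_simps)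
  then show ?thesis using assms by (simp add: divide_simps power2_eq_square algebra_simps)
qed

theorem mainTheorem1:
  fixes \<Omega> B :: "(real ^ 3) set"
    and \<sigma> :: "real ^ 3 \<Rightarrow> real"
    and \<mu> :: "(real ^ 3) measure"
    and \<phi> :: "nat \<Rightarrow> nat \<Rightarrow> real ^ 3 \<Rightarrow> real"
    and \<nu> :: "nat \<Rightarrow> nat"
    and P :: "nat \<Rightarrow> nat \<Rightarrow> real ^ 3"
    and u m w :: "nat \<Rightarrow> nat \<Rightarrow> real"
  assumes "general_polyhedron \<Omega>" and "compact \<Omega>" and "interior \<Omega> \<noteq> {}"
    and "bounding_box B \<Omega>"
    and "\<sigma> \<in> L1_plus B"
    and "AE x in lebesgue_on \<Omega>. 0 < \<sigma> x" and "(\<lambda>x. 1 / \<sigma> x) \<in> L1_plus \<Omega>"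
    and "\<mu> = density_measure B \<sigma>"
    and "\<And>n. basis_poly3 n (\<phi> n)"
    and "\<And>n. orthonormal_wrt \<mu> {1..dim_poly3 n} (\<phi> n)"
    and "\<And>n i. i \<in> {1..\<nu> n} \<Longrightarrow> P n i \<in> B \<and> 0 < u n i"
    and "\<And>n. exact_on \<mu> (\<nu> n) (P n) (u n) (poly3 (2 * n))"
    and "\<And>n j. j \<in> {1..dim_poly3 n} \<Longrightarrow> m n j = (\<integral>x. \<phi> n j x \<partial>lebesgue_on \<Omega>)"
    and "\<And>n i. i \<in> {1..\<nu> n} \<Longrightarrow> w n i = u n i * (\<Sum>j=1..dim_poly3 n. \<phi> n j (P n i) * m n j)"
  shows "(\<forall>n. \<forall>f\<in>poly3 n. (\<integral>x. f x \<partial>lebesgue_on \<Omega>) = (\<Sum>i=1..\<nu> n. w n i * f (P n i)))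
    \<and> (\<lambda>n. \<Sum>i=1..\<nu> n. \<bar>w n i\<bar>) \<longlonglongrightarrow> measure lebesgue \<Omega>"
proof (intro conjI allI ballI)
  note \<mu> = \<open>\<mu> = density_measure B \<sigma>\<close> and \<sigma> = \<open>\<sigma> \<in> L1_plus B\<close>
    and \<sigma>_pos = \<open>AE x in lebesgue_on \<Omega>. 0 < \<sigma> x\<close>
  have nodes: "P n i \<in> B" and weights: "0 < u n i" if "i \<in> {1..\<nu> n}" for n i
    using assms(11)[OF that] by auto
  have B: "compact B" "\<Omega> \<subseteq> B"
    using assms(4) by (auto simp: bounding_box_def)
  have leb: "B \<in> sets lebesgue" "\<Omega> \<in> sets lebesgue"
    using B \<open>compact \<Omega>\<close> by (auto simp: compact_imp_closed)
  have fin: "finite_measure \<mu>" unfolding \<mu> using \<sigma> by (rule finite_measure_density_measure)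
  interpret finite_measure \<mu> by (fact fin)
  have sets: "sets \<mu> = sets (lebesgue_on B)" by (simp add: \<mu> sets_density_measure)
  have space: "space \<mu> = B" using sets_eq_imp_space_eq[OF sets] by simp
  have meas_iff: "f \<in> borel_measurable \<mu> \<longleftrightarrow> f \<in> borel_measurable (lebesgue_on B)" for f :: "_ \<Rightarrow> real"
    by (simp add: measurable_cong_sets[OF sets refl])
  note int_cont = integrable_continuous_on_compact[OF fin B(1) sets]
  define h where "h = recip_on \<Omega> \<sigma>"
  \<comment> \<open>The guard \<open>0 < \<sigma> x\<close> in \<open>recip_on\<close> yields
    nonnegativity at every point, as the approximation lemmas require, although \<sigma> is positive
    only almost everywhere on \<Omega>.\<close>
  have h_nonneg: "0 \<le> h x" for x by (simp add: h_def recip_on_def)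
  have "\<sigma> \<in> borel_measurable \<mu>" using \<sigma> by (auto simp: meas_iff L1_plus_def)
  moreover have "\<Omega> \<in> sets \<mu>" using leb B by (simp add: sets sets_restrict_space_iff)
  ultimately have h_meas[measurable]: "h \<in> borel_measurable \<mu>"
    unfolding h_def by (rule borel_measurable_recip_on)
  have h_integrable_iff: "integrable \<mu> (\<lambda>x. h x * f x) \<longleftrightarrow> integrable (lebesgue_on \<Omega>) f"
    and h_integral: "(\<integral>x. h x * f x \<partial>\<mu>) = (\<integral>x. f x \<partial>lebesgue_on \<Omega>)"
    if "f \<in> borel_measurable \<mu>" for f
    using density_measure_recip_on[OF leb B(2) \<sigma> \<sigma>_pos, of f] that
    by (simp_all add: \<mu> h_def meas_iff[unfolded \<mu>])
  have "integrable (lebesgue_on \<Omega>) h"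
  proof -
    have "AE x in lebesgue_on \<Omega>. 1 / \<sigma> x = h x"
      using \<sigma>_pos AE_space by eventually_elim (simp add: h_def recip_on_def)
    moreover have "h \<in> borel_measurable (lebesgue_on \<Omega>)"
      using h_meas B(2) measurable_restrict_mono unfolding meas_iff by blast
    ultimately show ?thesis
      using assms(7) by (auto simp: L1_plus_def intro: integrable_cong_AE_imp)
  qed
  \<comment> \<open>Taking f = h in \<open>h_integrable_iff\<close> identifies integrability of 1 /
    \<sigma> over \<Omega> with square integrability of h for \<mu>.\<close>
  then have h2: "integrable \<mu> (\<lambda>x. (h x)\<^sup>2)"
    by (simp add: power2_eq_square h_integrable_iff)
  have poly_int: "integrable \<mu> p" if "p \<in> poly3 n" for p n
    using that by (intro int_cont continuous_on_poly3)
  have hp_int: "integrable \<mu> (\<lambda>x. h x * p x)" if "p \<in> poly3 n" for p n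
  proof -
    have "integrable (lebesgue_on \<Omega>) p"
      using that \<open>compact \<Omega>\<close>
      by (intro integrable_continuous_on_compact[OF _ \<open>compact \<Omega>\<close> refl] continuous_on_poly3)
        (auto intro!: finite_measure_lebesgue_on lmeasurable_compact)
    then show ?thesis using poly_int[OF that] by (simp add: h_integrable_iff)
  qed
  define g where "g n x = (\<Sum>j=1..dim_poly3 n. m n j * \<phi> n j x)" for n x
  have \<phi>_poly: "\<phi> n j \<in> poly3 n" if "j \<in> {1..dim_poly3 n}" for n j
    using assms(9)[of n] that unfolding basis_poly3_def by blast
  have g_poly: "g n \<in> poly3 n" for n
    unfolding g_def[abs_def] by (intro poly3_sum poly3_cmult \<phi>_poly)
  have m_h: "m n j = (\<integral>x. h x * \<phi> n j x \<partial>\<mu>)" if "j \<in> {1..dim_poly3 n}" for n j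
    using that assms(13) poly_int[OF \<phi>_poly[OF that]] by (simp add: h_integral)
  \<comment> \<open>The defining property of the orthogonal projection: h - \<open>g n\<close> is
    orthogonal to \<open>poly3 n\<close>. Expanding p in the basis, orthonormality collapses the
    double sum to the diagonal, and \<open>m_h\<close> turns what remains into the integral with
    h.\<close>
  have proj: "(\<integral>x. g n x * p x \<partial>\<mu>) = (\<integral>x. h x * p x \<partial>\<mu>)" if p: "p \<in> poly3 n" for n p
  proof -
    let ?J = "{1..dim_poly3 n}"
    obtain c where c: "\<And>x. p x = (\<Sum>k\<in>?J. c k * \<phi> n k x)"
      using assms(9)[of n] p unfolding basis_poly3_def by blast
    have int2: "integrable \<mu> (\<lambda>x. \<phi> n j x * \<phi> n k x)" if "j \<in> ?J" "k \<in> ?J" for j k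
      by (rule poly_int[OF poly3_mult[OF \<phi>_poly[OF that(1)] \<phi>_poly[OF that(2)]]])
    have "(\<integral>x. g n x * p x \<partial>\<mu>)
        = (\<integral>x. (\<Sum>j\<in>?J. \<Sum>k\<in>?J. (m n j * c k) * (\<phi> n j x * \<phi> n k x)) \<partial>\<mu>)"
      unfolding g_def c sum_product by (simp add: mult_ac)
    also have "\<dots> = (\<Sum>j\<in>?J. \<Sum>k\<in>?J. (m n j * c k) * (\<integral>x. \<phi> n j x * \<phi> n k x \<partial>\<mu>))"
    proof (subst Bochner_Integration.integral_sum)
      show "(\<Sum>j\<in>?J. \<integral>x. (\<Sum>k\<in>?J. (m n j * c k) * (\<phi> n j x * \<phi> n k x)) \<partial>\<mu>)
          = (\<Sum>j\<in>?J. \<Sum>k\<in>?J. (m n j * c k) * (\<integral>x. \<phi> n j x * \<phi> n k x \<partial>\<mu>))"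
        by (intro sum.cong refl, subst Bochner_Integration.integral_sum)
          (intro integrable_mult_right int2, assumption+, simp)
    qed (intro Bochner_Integration.integrable_sum integrable_mult_right int2)
    also have "\<dots> = (\<Sum>j\<in>?J. \<Sum>k\<in>?J. (m n j * c k) * (if j = k then 1 else 0))"
      using assms(10)[of n] unfolding orthonormal_wrt_def by (intro sum.cong refl) simp
    also have "\<dots> = (\<Sum>k\<in>?J. c k * m n k)"
      by (simp add: if_distrib[of "\<lambda>r. _ * r"] mult.commute cong: if_cong)
    also have "\<dots> = (\<Sum>k\<in>?J. c k * (\<integral>x. h x * \<phi> n k x \<partial>\<mu>))"
      by (simp add: m_h)
    also have "\<dots> = (\<integral>x. (\<Sum>k\<in>?J. c k * (h x * \<phi> n k x)) \<partial>\<mu>)"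
      using hp_int[OF \<phi>_poly] by (subst Bochner_Integration.integral_sum) simp_all
    also have "\<dots> = (\<integral>x. h x * p x \<partial>\<mu>)"
      unfolding c by (simp add: sum_distrib_left mult_ac)
    finally show ?thesis .
  qed
  have quad: "(\<integral>x. p x \<partial>\<mu>) = (\<Sum>i=1..\<nu> n. u n i * p (P n i))" if "p \<in> poly3 (2 * n)" for p n
    using assms(12)[of n] that unfolding exact_on_def by blast
  have w: "w n i = u n i * g n (P n i)" if "i \<in> {1..\<nu> n}" for n i
    using assms(14)[OF that] by (simp add: g_def mult.commute)
  have exact: "(\<integral>x. f x \<partial>lebesgue_on \<Omega>) = (\<Sum>i=1..\<nu> n. w n i * f (P n i))"
    if f: "f \<in> poly3 n" for n f
  proof -
    \<comment> \<open>Replacing h by its projection turns the integrand into a polynomial of degree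
      at most 2n, on which the quadrature is exact.\<close>
    have "(\<integral>x. f x \<partial>lebesgue_on \<Omega>) = (\<integral>x. g n x * f x \<partial>\<mu>)"
      using proj[OF f] poly_int[OF f] by (simp add: h_integral)
    also have "\<dots> = (\<Sum>i=1..\<nu> n. u n i * (g n (P n i) * f (P n i)))"
      using poly3_mult[OF g_poly f] by (intro quad) (simp add: mult_2)
    also have "\<dots> = (\<Sum>i=1..\<nu> n. w n i * f (P n i))"
      by (intro sum.cong refl) (simp add: w)
    finally show ?thesis .
  qed
  show "(\<integral>x. f x \<partial>lebesgue_on \<Omega>) = (\<Sum>i=1..\<nu> n. w n i * f (P n i))" if "f \<in> poly3 n" for n f
    using that by (rule exact)

  have vol: "(\<integral>x. 1 \<partial>lebesgue_on \<Omega>) = measure lebesgue \<Omega>"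
    using leb(2) by (simp add: measure_restrict_space)
  have h_vol: "(\<integral>x. h x \<partial>\<mu>) = measure lebesgue \<Omega>"
    using h_integral[of "\<lambda>_. 1"] vol by simp
  have h_int: "integrable \<mu> h" using hp_int[OF poly3_const[of 1 0]] by simp
  have lower: "measure lebesgue \<Omega> \<le> (\<Sum>i=1..\<nu> n. \<bar>w n i\<bar>)" for n
  proof -
    have "measure lebesgue \<Omega> = (\<Sum>i=1..\<nu> n. w n i)"
      using exact[OF poly3_const[of 1 n]] vol by simp
    also have "\<dots> \<le> (\<Sum>i=1..\<nu> n. \<bar>w n i\<bar>)" by (intro sum_mono) simp
    finally show ?thesis .
  qed
  define K where "K = measure \<mu> B"
  have K: "0 \<le> K" by (simp add: K_def)
  \<comment> \<open>Neither q nor \<delta> depends on n, so one choice of both serves all n from the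
    degree of q onwards.\<close>
  have upper: "(\<Sum>i=1..\<nu> n. \<bar>w n i\<bar>) \<le> measure lebesgue \<Omega> + \<delta> * K + (\<integral>x. (h x - q x)\<^sup>2 \<partial>\<mu>) / \<delta>"
    if q: "q \<in> poly3 n" "\<And>x. x \<in> B \<Longrightarrow> 0 \<le> q x" and \<delta>: "0 < \<delta>" for q n \<delta>
  proof -
    let ?D = "\<integral>x. (h x - q x)\<^sup>2 \<partial>\<mu>"
    define r where "r x = g n x - q x" for x
    have r: "r \<in> poly3 n"
      using poly3_add[OF g_poly poly3_cmult[OF q(1), of "-1"]] by (simp add: r_def[abs_def])
    have r2: "(\<lambda>x. (r x)\<^sup>2) \<in> poly3 (2 * n)"
      using poly3_mult[OF r r] by (simp add: power2_eq_square mult_2)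
    have q2: "(\<lambda>x. (q x)\<^sup>2) \<in> poly3 (2 * n)"
      using poly3_mult[OF q(1) q(1)] by (simp add: power2_eq_square mult_2)
    have hq2: "integrable \<mu> (\<lambda>x. (h x - q x)\<^sup>2)"
      using h2 hp_int[OF q(1)] poly_int[OF q2] by (simp add: power2_diff mult.assoc)
    have rg: "integrable \<mu> (\<lambda>x. g n x * r x)" and rq: "integrable \<mu> (\<lambda>x. q x * r x)"
      using poly3_mult[OF g_poly r] poly3_mult[OF q(1) r] poly_int by blast+
    \<comment> \<open>Since r is the projection of h - q, its norm is at most that of h - q:
      \<open>proj\<close> replaces \<open>g n\<close> by h, and ab \<le> (a^2 + b^2) / 2 leaves half
      of the integral of r^2 on the right, to be absorbed on the left.\<close>
    have "(\<integral>x. (r x)\<^sup>2 \<partial>\<mu>) = (\<integral>x. g n x * r x - q x * r x \<partial>\<mu>)"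
      by (simp add: r_def power2_eq_square left_diff_distrib)
    also have "\<dots> = (\<integral>x. h x * r x \<partial>\<mu>) - (\<integral>x. q x * r x \<partial>\<mu>)"
      using rg rq proj[OF r] by simp
    also have "\<dots> = (\<integral>x. (h x - q x) * r x \<partial>\<mu>)"
      using hp_int[OF r] rq by (simp add: left_diff_distrib)
    also have "\<dots> \<le> (\<integral>x. ((h x - q x)\<^sup>2 + (r x)\<^sup>2) / 2 \<partial>\<mu>)"
    proof (rule integral_mono)
      show "integrable \<mu> (\<lambda>x. (h x - q x) * r x)"
        using hp_int[OF r] rq by (simp add: left_diff_distrib)
      show "integrable \<mu> (\<lambda>x. ((h x - q x)\<^sup>2 + (r x)\<^sup>2) / 2)"
        using hq2 poly_int[OF r2] by simp
      have "a * b \<le> (a\<^sup>2 + b\<^sup>2) / 2" for a b :: real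
        using sum_squares_bound[of a b] by simp
      then show "(h x - q x) * r x \<le> ((h x - q x)\<^sup>2 + (r x)\<^sup>2) / 2" for x .
    qed
    also have "\<dots> = (?D + (\<integral>x. (r x)\<^sup>2 \<partial>\<mu>)) / 2"
      using hq2 poly_int[OF r2] by simp
    finally have r_le: "(\<integral>x. (r x)\<^sup>2 \<partial>\<mu>) \<le> ?D" by simp
    \<comment> \<open>|r| need not be a polynomial, but \<open>abs_le_add_square_div\<close>
      majorizes it by one of degree at most 2n. Thus s dominates |\<open>g n\<close>| on B, and the
      quadrature sum of s is its integral.\<close>
    define s where "s x = \<delta> / 2 + 1 / (2 * \<delta>) * (r x)\<^sup>2 + q x" for x
    have s: "s \<in> poly3 (2 * n)"
      unfolding s_def[abs_def]
      by (intro poly3_add poly3_const poly3_cmult r2 poly3_mono[OF q(1)]) simp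
    have "(\<Sum>i=1..\<nu> n. \<bar>w n i\<bar>) \<le> (\<Sum>i=1..\<nu> n. u n i * s (P n i))"
    proof (rule sum_mono)
      fix i assume i: "i \<in> {1..\<nu> n}"
      have "\<bar>g n (P n i)\<bar> \<le> \<bar>r (P n i)\<bar> + q (P n i)"
        using q(2)[OF nodes[OF i]] by (simp add: r_def)
      also have "\<dots> \<le> s (P n i)"
        using abs_le_add_square_div[OF \<delta>, of "r (P n i)"] by (simp add: s_def)
      finally show "\<bar>w n i\<bar> \<le> u n i * s (P n i)"
        using weights[OF i] by (simp add: w[OF i] abs_mult)
    qed
    also have "\<dots> = (\<integral>x. s x \<partial>\<mu>)" using quad[OF s] by simp
    also have "\<dots> = \<delta> * K / 2 + (\<integral>x. (r x)\<^sup>2 \<partial>\<mu>) / (2 * \<delta>) + (\<integral>x. q x \<partial>\<mu>)"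
      unfolding s_def using poly_int[OF r2] poly_int[OF q(1)] by (simp add: K_def space)
    \<comment> \<open>The same inequality applied to h - q compares the integral of q with that of
      h; its two error terms double those from r, giving \<delta>K and D / \<delta>, where D is the
      integral of (h - q)^2.\<close>
    also have "(\<integral>x. q x \<partial>\<mu>) \<le> (\<integral>x. h x + (\<delta> / 2 + (h x - q x)\<^sup>2 / (2 * \<delta>)) \<partial>\<mu>)"
    proof (rule integral_mono[OF poly_int[OF q(1)]])
      show "integrable \<mu> (\<lambda>x. h x + (\<delta> / 2 + (h x - q x)\<^sup>2 / (2 * \<delta>)))"
        using h_int hq2 by simp
      show "q x \<le> h x + (\<delta> / 2 + (h x - q x)\<^sup>2 / (2 * \<delta>))" for x
        using abs_le_add_square_div[OF \<delta>, of "h x - q x"] by linarith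
    qed
    also have "\<dots> = measure lebesgue \<Omega> + \<delta> * K / 2 + ?D / (2 * \<delta>)"
      using h_int hq2 by (simp add: h_vol K_def space)
    also have "(\<integral>x. (r x)\<^sup>2 \<partial>\<mu>) / (2 * \<delta>) \<le> ?D / (2 * \<delta>)"
      using r_le \<delta> by (intro divide_right_mono) auto
    finally show ?thesis by (simp add: algebra_simps)
  qed
  show "(\<lambda>n. \<Sum>i=1..\<nu> n. \<bar>w n i\<bar>) \<longlonglongrightarrow> measure lebesgue \<Omega>"
  proof (rule LIMSEQ_I)
    fix e :: real
    assume e: "0 < e"
    \<comment> \<open>\<delta> is fixed first, so that \<delta>K is at most e / 2 even if K = 0;
      only then is q chosen, with squared error below \<delta>e / 2, so that division by \<delta>
      leaves less than e / 2.\<close>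
    define \<delta> where "\<delta> = e / (2 * (K + 1))"
    have \<delta>: "0 < \<delta>" using e K by (simp add: \<delta>_def)
    have "\<delta> * K \<le> \<delta> * (K + 1)" using \<delta> by simp
    also have "\<dots> = e / 2" using K by (simp add: \<delta>_def divide_simps)
    finally have \<delta>K: "\<delta> * K \<le> e / 2" .
    have ac: "AE x in \<mu>. x \<notin> N" if "negligible N" for N
      unfolding \<mu> using \<sigma> leb(1) that by (rule AE_density_measure_notin_negligible)
    obtain q where q: "real_polynomial_function q" "\<And>x. x \<in> B \<Longrightarrow> 0 \<le> q x"
      and D: "(\<integral>x. (h x - q x)\<^sup>2 \<partial>\<mu>) < \<delta> * e / 2"
      using L2_approx_nonneg_polynomial[OF fin B(1) sets ac h_meas h_nonneg h2, of "\<delta> * e / 2"] \<delta> e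
      by auto
    obtain n0 where n0: "q \<in> poly3 n0"
      using real_polynomial_function_imp_poly3[OF q(1)] by blast
    have D': "(\<integral>x. (h x - q x)\<^sup>2 \<partial>\<mu>) / \<delta> < e / 2"
      using D \<delta> by (simp add: field_simps)
    have "norm ((\<Sum>i=1..\<nu> n. \<bar>w n i\<bar>) - measure lebesgue \<Omega>) < e" if "n0 \<le> n" for n
      using upper[OF poly3_mono[OF n0 that] q(2) \<delta>] lower[of n] \<delta>K D'
      unfolding real_norm_def by linarith
    then show "\<exists>n0. \<forall>n\<ge>n0. norm ((\<Sum>i=1..\<nu> n. \<bar>w n i\<bar>) - measure lebesgue \<Omega>) < e" by blast
  qed
qed

end
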